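(* Let $X$ be an Archimedean pervasive pre-Riesz space and let $a\in X$ be an atom. Then there is an order projection $P\colon X\to X$ with range $\mathcal B_a$.
   Context: All vector spaces are real. An ordered vector space $X$ is a real vector space with a cone $X_+$ (closed under addition and multiplication by nonnegative scalars, $X_+\cap(-X_+)=\{0\}$), ordered by $x\le y$ iff $y-x\in X_+$. It is Archimedean if $nx\le y$ for all $n\in\mathbb N$ implies $x\le 0$. A linear subspace $D$ of an ordered vector space $Y$ is order dense in $Y$ if $y=\inf\{z\in D: y\le z\}$ for every $y\in Y$. An ordered vector space $X$ is a pre-Riesz space if there exist a vector lattice $Y$ and a bipositive linear map $i\colon X\to Y$ (i.e. $i(x)\ge 0$ iff $x\ge 0$) such that $i(X)$ is order dense in $Y$; then $(Y,i)$ is called a vector lattice cover of $X$. A pre-Riesz space $X$ is pervasive if for some (equivalently, every) vector lattice cover $(Y,i)$ of $X$, for every $y\in Y_+$ with $y\ne 0$ there is $x\in X$ with $0<i(x)\le y$. For $M\subseteq X$, $M^u$ is the set of upper bounds of $M$ in $X$. Elements $x,y\in X$ are disjoint, $x\perp y$, if $\{x+y,-x-y\}^u=\{x-y,-x+y\}^u$. The disjoint complement of $M\subseteq X$ is $M^{\mathrm{d}}=\{x\in X: x\perp y\text{ for all }y\in M\}$, and $M^{\mathrm{dd}}=(M^{\mathrm{d}})^{\mathrm{d}}$. A linear subspace $B$ is a band if $B^{\mathrm{dd}}=B$. $\mathcal B_a$ is the intersection of all bands in $X$ containing $a$; one has $\mathcal B_a=\{a\}^{\mathrm{dd}}$. An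 element $a\in X_+\setminus\{0\}$ is an atom if $0\le x\le a$ implies $x=\lambda a$ for some real $\lambda\ge 0$. For linear operators $S,T\colon X\to X$, $S\le T$ means $(T-S)(X_+)\subseteq X_+$. An order projection on $X$ is a linear operator $P\colon X\to X$ with $P^2=P$ and $0\le P\le I$, where $I$ is the identity operator. *)

theory Defs
  imports "HOL-Analysis.Analysis" "HOL-Library.Lub_Glb"
begin

text \<open>
  An ordered vector space is a type of class \<^class>\<open>ordered_real_vector\<close>; its cone is the set of
  all \<open>x \<ge> 0\<close>. A vector lattice is a type that is in addition of class \<^class>\<open>lattice\<close>.
\<close>

definition archimedean :: "'a::ordered_real_vector itself \<Rightarrow> bool" where
  "archimedean _ \<longleftrightarrow> (\<forall>x y :: 'a. (\<forall>n::nat. real n *\<^sub>R x \<le> y) \<longrightarrow> x \<le> 0)"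

definition order_dense :: "'y::ordered_real_vector set \<Rightarrow> bool" where
  "order_dense D \<longleftrightarrow> subspace D \<and> (\<forall>y. isGlb UNIV {z \<in> D. y \<le> z} y)"

definition bipositive :: "('a::ordered_real_vector \<Rightarrow> 'y::ordered_real_vector) \<Rightarrow> bool" where
  "bipositive i \<longleftrightarrow> (\<forall>x. 0 \<le> i x \<longleftrightarrow> 0 \<le> x)"

definition vector_lattice_cover ::
    "('a::ordered_real_vector \<Rightarrow> 'y::{ordered_real_vector, lattice}) \<Rightarrow> bool" where
  "vector_lattice_cover i \<longleftrightarrow> linear i \<and> bipositive i \<and> order_dense (range i)"

text \<open>
  HOL cannot quantify over the vector lattice \<open>Y\<close> inside a formula, so the next two predicates carry
  it as a type argument. As an assumption of a theorem whose conclusion does not mention \<open>'y\<close>,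
  with \<open>'y\<close> a free type variable, each of them says that some vector lattice \<open>Y\<close> of the required kind
  exists.
\<close>

definition pre_Riesz_space ::
    "'a::ordered_real_vector itself \<Rightarrow> 'y::{ordered_real_vector, lattice} itself \<Rightarrow> bool" where
  "pre_Riesz_space _ _ \<longleftrightarrow> (\<exists>i :: 'a \<Rightarrow> 'y. vector_lattice_cover i)"

definition pervasive_space ::
    "'a::ordered_real_vector itself \<Rightarrow> 'y::{ordered_real_vector, lattice} itself \<Rightarrow> bool" where
  "pervasive_space _ _ \<longleftrightarrow>
     (\<exists>i :: 'a \<Rightarrow> 'y. vector_lattice_cover i \<and>
        (\<forall>y. 0 \<le> y \<and> y \<noteq> 0 \<longrightarrow> (\<exists>x. 0 < i x \<and> i x \<le> y)))"

definition upper_bounds :: "'a::ordered_real_vector set \<Rightarrow> 'a set" where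
  "upper_bounds M = {u. \<forall>m\<in>M. m \<le> u}"

definition disjoint_elts :: "'a::ordered_real_vector \<Rightarrow> 'a \<Rightarrow> bool" where
  "disjoint_elts x y \<longleftrightarrow> upper_bounds {x + y, - x - y} = upper_bounds {x - y, - x + y}"

definition disjoint_compl :: "'a::ordered_real_vector set \<Rightarrow> 'a set" where
  "disjoint_compl M = {x. \<forall>y\<in>M. disjoint_elts x y}"

definition band :: "'a::ordered_real_vector set \<Rightarrow> bool" where
  "band B \<longleftrightarrow> subspace B \<and> disjoint_compl (disjoint_compl B) = B"

definition generated_band :: "'a::ordered_real_vector \<Rightarrow> 'a set" where
  "generated_band a = \<Inter> {B. band B \<and> a \<in> B}"

definition atom :: "'a::ordered_real_vector \<Rightarrow> bool" where
  "atom a \<longleftrightarrow> 0 \<le> a \<and> a \<noteq> 0 \<and> (\<forall>x. 0 \<le> x \<and> x \<le> a \<longrightarrow> (\<exists>c::real. 0 \<le> c \<and> x = c *\<^sub>R a))"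

text \<open>The order on operators; it is not the pointwise order that \<open>\<le>\<close> denotes on functions.\<close>

definition operator_le :: "('a::ordered_real_vector \<Rightarrow> 'a) \<Rightarrow> ('a \<Rightarrow> 'a) \<Rightarrow> bool" where
  "operator_le S T \<longleftrightarrow> (\<forall>x. 0 \<le> x \<longrightarrow> 0 \<le> T x - S x)"

definition order_projection :: "('a::ordered_real_vector \<Rightarrow> 'a) \<Rightarrow> bool" where
  "order_projection P \<longleftrightarrow>
     linear P \<and> P \<circ> P = P \<and> operator_le (\<lambda>_. 0) P \<and> operator_le P id"

end

theory Submission
  imports Defs
begin

text \<open>
  Let \<open>i\<close> embed \<open>X\<close> into a vector lattice cover \<open>Y\<close> as in the definition of pervasiveness.
  Pervasiveness carries the two hypotheses on \<open>X\<close> over to \<open>Y\<close>: the lattice \<open>Y\<close> is Archimedean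
  (\<open>archimedean_cover\<close>) and \<open>e = i a\<close> is an atom of \<open>Y\<close> (\<open>atom_cover\<close>).

  In an Archimedean vector lattice, every \<open>y \<ge> 0\<close> has a largest multiple \<open>coord e y *\<^sub>R e\<close> of \<open>e\<close>
  below it. As \<open>e\<close> is an atom, the Riesz decomposition property makes \<open>coord e\<close> additive on the cone
  (\<open>coord_add\<close>), so that it extends to a linear functional on \<open>Y\<close>. The projection is
  \<open>P x = coord e (i x) *\<^sub>R a\<close> for \<open>x \<ge> 0\<close>; its range is the line spanned by \<open>a\<close>.

  It remains to see that this line is a band, since every band containing \<open>a\<close> contains the line.
  Let \<open>x\<close> be in its double disjoint complement, and let \<open>r = p - coord e p *\<^sub>R e\<close>, where \<open>p\<close> is the
  positive part of \<open>i x\<close>. If \<open>r \<noteq> 0\<close>, there is \<open>z\<close> with \<open>0 < i z \<le> r\<close>. Then \<open>i z\<close>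
  dominates no positive multiple of \<open>e\<close>, so that \<open>z\<close> is disjoint from the line, hence from \<open>x\<close>,
  although \<open>i z \<le> p\<close>: a contradiction. So the positive part of \<open>i x\<close>, and likewise its negative
  part, is a multiple of \<open>e\<close>.
\<close>

section \<open>Positive and negative parts in a vector lattice\<close>

lemma pos_part_minus_neg_part:
  fixes u :: "'y::{ordered_real_vector, lattice}"
  shows "sup u 0 - sup (- u) 0 = u"
proof -
  have "sup (- u) 0 \<le> sup u 0 - u"
    by (rule sup_least) simp_all
  moreover have "sup u 0 \<le> u + sup (- u) 0"
  proof (rule sup_least)
    show "0 \<le> u + sup (- u) 0"
      by (metis add_left_mono add.right_inverse sup_ge1)
  qed simp
  ultimately show ?thesis
    by (metis add.commute antisym diff_eq_eq le_diff_eq)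
qed

lemma pos_part_neg_part_disjoint:
  fixes u :: "'y::{ordered_real_vector, lattice}"
  assumes "h \<le> sup u 0" and "h \<le> sup (- u) 0"
  shows "h \<le> 0"
proof -
  have "h \<le> sup u 0 - u"
    using assms(2) pos_part_minus_neg_part[of u] by (metis add_diff_cancel_left' diff_add_cancel)
  then have "sup u 0 \<le> sup u 0 - h"
    using assms(1) by (intro sup_least) (simp_all add: algebra_simps)
  then show ?thesis
    by (simp only: le_diff_eq add_le_same_cancel1)
qed

text \<open>
  The last hypothesis is \<open>v + u \<le> \<bar>v - u\<bar>\<close>, a consequence of \<open>v\<close> and \<open>u\<close> being disjoint. This
  half of disjointness suffices, and it is what passes easily from \<open>X\<close> to its cover.
\<close>

lemma le_pos_part_disjoint_imp_le_0:
  fixes u v :: "'y::{ordered_real_vector, lattice}"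
  assumes "0 \<le> v" and "v \<le> sup u 0" and "v + u \<le> sup (v - u) (u - v)"
  shows "v \<le> 0"
proof -
  let ?p = "sup u 0" and ?n = "sup (- u) 0"
  have u: "u = ?p - ?n"
    by (simp add: pos_part_minus_neg_part)
  have "v - u \<le> ?n"
    using assms(2) by (subst u) (simp add: algebra_simps)
  moreover have "?n \<le> ?n + (?p - v)"
    using assms(2) by (simp add: algebra_simps)
  moreover have "u - v \<le> ?p - v"
    by simp
  moreover have "?p - v \<le> ?n + (?p - v)"
    by simp
  ultimately have "sup (v - u) (u - v) \<le> ?n + (?p - v)"
    by (meson order_trans sup_least)
  with assms(3) have "v + u \<le> ?n + (?p - v)"
    by (rule order_trans)
  then have "v + (?p - ?n) \<le> ?n + (?p - v)"
    by (simp only: u[symmetric])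
  then have "v + v \<le> ?n + ?n"
    by (simp add: algebra_simps)
  then have "2 *\<^sub>R v \<le> 2 *\<^sub>R ?n"
    by (simp only: scaleR_2)
  then have "v \<le> ?n"
    by (subst (asm) scaleR_le_cancel_left_pos) simp_all
  with assms(2) show ?thesis
    by (rule pos_part_neg_part_disjoint)
qed

text \<open>Kantorovich extension of an additive, positively homogeneous functional from the cone to the whole
  vector lattice, as the difference of its values at the positive and the negative part.\<close>

lemma linear_extension_from_cone:
  fixes f :: "'y::{ordered_real_vector, lattice} \<Rightarrow> real"
  assumes add: "\<And>x y. 0 \<le> x \<Longrightarrow> 0 \<le> y \<Longrightarrow> f (x + y) = f x + f y"
    and scale: "\<And>c y. 0 < c \<Longrightarrow> 0 \<le> y \<Longrightarrow> f (c *\<^sub>R y) = c * f y"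
  obtains g where "linear g" and "\<And>y. 0 \<le> y \<Longrightarrow> g y = f y"
proof -
  define g where "g y = f (sup y 0) - f (sup (- y) 0)" for y
  have g: "g (p - q) = f p - f q" if "0 \<le> p" "0 \<le> q" for p q
  proof -
    let ?u = "p - q"
    have "p + sup (- ?u) 0 = q + sup ?u 0"
      using pos_part_minus_neg_part[of ?u] by (metis add.commute diff_add_cancel diff_add_eq)
    then have "f p + f (sup (- ?u) 0) = f q + f (sup ?u 0)"
      using that add by (metis sup_ge2)
    then show ?thesis
      by (simp add: g_def)
  qed
  have f0: "f 0 = 0"
    using add[of 0 0] by simp
  have g_minus: "g (- y) = - g y" for y
    by (simp add: g_def)
  have g_scale_pos: "g (c *\<^sub>R y) = c * g y" if "0 < c" for c y
  proof -
    have "c *\<^sub>R y = c *\<^sub>R sup y 0 - c *\<^sub>R sup (- y) 0"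
      by (simp add: pos_part_minus_neg_part flip: scaleR_diff_right)
    then have "g (c *\<^sub>R y) = f (c *\<^sub>R sup y 0) - f (c *\<^sub>R sup (- y) 0)"
      using that by (simp add: g scaleR_nonneg_nonneg)
    then show ?thesis
      using that by (simp add: scale g_def right_diff_distrib)
  qed
  have "linear g"
  proof (rule linearI)
    fix x y :: 'y
    have "x + y = (sup x 0 + sup y 0) - (sup (- x) 0 + sup (- y) 0)"
      using pos_part_minus_neg_part[of x] pos_part_minus_neg_part[of y]
      by (simp add: add_diff_add)
    then have "g (x + y) = f (sup x 0 + sup y 0) - f (sup (- x) 0 + sup (- y) 0)"
      by (simp add: g)
    then show "g (x + y) = g x + g y"
      by (simp add: add g_def)
  next
    fix c and y :: 'y
    show "g (c *\<^sub>R y) = c *\<^sub>R g y"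
    proof (cases c "0::real" rule: linorder_cases)
      case less
      then show ?thesis
        using g_scale_pos[of "- c" y] g_minus[of "c *\<^sub>R y"] by simp
    next
      case equal
      then show ?thesis
        by (simp add: g_def)
    next
      case greater
      then show ?thesis
        by (simp add: g_scale_pos)
    qed
  qed
  moreover have "g y = f y" if "0 \<le> y" for y
    using g[of y 0] that f0 by simp
  ultimately show ?thesis
    by (rule that)
qed

section \<open>The coordinate along an atom\<close>

text \<open>
  The largest \<open>c\<close> with \<open>c *\<^sub>R e \<le> y\<close>; it is meaningful in an Archimedean space for \<open>e > 0\<close> and
  \<open>y \<ge> 0\<close>, where \<open>coord_scaleR_le\<close> and \<open>le_coord\<close> characterise it.
\<close>

definition coord :: "'y::ordered_real_vector \<Rightarrow> 'y \<Rightarrow> real" where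
  "coord e y = Sup {c. c *\<^sub>R e \<le> y}"

lemma bdd_above_coord:
  fixes e y :: "'y::ordered_real_vector"
  assumes "archimedean TYPE('y)" and "0 < e"
  shows "bdd_above {c::real. c *\<^sub>R e \<le> y}"
proof -
  obtain n :: nat where n: "\<not> real n *\<^sub>R e \<le> y"
    using assms unfolding archimedean_def by (meson less_le_not_le)
  show ?thesis
  proof (rule bdd_aboveI)
    fix c :: real
    assume "c \<in> {c. c *\<^sub>R e \<le> y}"
    then have "c *\<^sub>R e \<le> y"
      by simp
    then show "c \<le> real n"
      using n assms(2) by (meson linorder_le_cases order_less_imp_le order_trans scaleR_right_mono)
  qed
qed

lemma le_coord:
  fixes e y :: "'y::ordered_real_vector"
  assumes "archimedean TYPE('y)" and "0 < e" and "c *\<^sub>R e \<le> y"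
  shows "c \<le> coord e y"
  unfolding coord_def using assms by (intro cSup_upper bdd_above_coord) simp_all

lemma coord_nonneg:
  fixes e y :: "'y::ordered_real_vector"
  assumes "archimedean TYPE('y)" and "0 < e" and "0 \<le> y"
  shows "0 \<le> coord e y"
  using assms by (intro le_coord) simp_all

lemma coord_scaleR_le:
  fixes e y :: "'y::ordered_real_vector"
  assumes arch: "archimedean TYPE('y)" and e: "0 < e" and y: "0 \<le> y"
  shows "coord e y *\<^sub>R e \<le> y"
proof -
  let ?l = "coord e y"
  have "real n *\<^sub>R (?l *\<^sub>R e - y) \<le> e" for n
  proof (cases "n = 0")
    case True
    then show ?thesis
      using e by simp
  next
    case False
    then have "?l - 1 / real n < ?l"
      by simp
    moreover have "{c. c *\<^sub>R e \<le> y} \<noteq> {}"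
      using y by (auto intro: exI[of _ 0])
    ultimately obtain c where c: "c *\<^sub>R e \<le> y" "?l - 1 / real n < c"
      unfolding coord_def by (metis less_cSupD mem_Collect_eq)
    have "(?l - 1 / real n) *\<^sub>R e \<le> c *\<^sub>R e"
      using c(2) e by (intro scaleR_right_mono) simp_all
    with c(1) have "(?l - 1 / real n) *\<^sub>R e \<le> y"
      by (rule order_trans[rotated])
    then have "?l *\<^sub>R e - y \<le> (1 / real n) *\<^sub>R e"
      by (simp add: algebra_simps)
    then have "real n *\<^sub>R (?l *\<^sub>R e - y) \<le> real n *\<^sub>R ((1 / real n) *\<^sub>R e)"
      by (rule scaleR_left_mono) simp
    then show ?thesis
      using False by simp
  qed
  then have "?l *\<^sub>R e - y \<le> 0"
    using arch unfolding archimedean_def by blast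
  then show ?thesis
    by simp
qed

lemma coord_self:
  fixes e :: "'y::ordered_real_vector"
  assumes arch: "archimedean TYPE('y)" and e: "0 < e"
  shows "coord e e = 1"
proof (rule antisym)
  have "(coord e e - 1) *\<^sub>R e \<le> 0"
    using coord_scaleR_le[OF arch e, of e] e by (simp add: algebra_simps)
  then show "coord e e \<le> 1"
    using e by (smt (verit) scaleR_le_0_iff less_le_not_le)
  show "1 \<le> coord e e"
    using assms by (intro le_coord) simp_all
qed

lemma coord_scaleR:
  fixes e y :: "'y::ordered_real_vector"
  assumes arch: "archimedean TYPE('y)" and e: "0 < e" and y: "0 \<le> y" and c: "0 < c"
  shows "coord e (c *\<^sub>R y) = c * coord e y"
proof (rule antisym)
  have "coord e (c *\<^sub>R y) *\<^sub>R e \<le> c *\<^sub>R y"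
    using y c by (intro coord_scaleR_le[OF arch e]) (simp add: scaleR_nonneg_nonneg)
  then have "inverse c *\<^sub>R coord e (c *\<^sub>R y) *\<^sub>R e \<le> inverse c *\<^sub>R c *\<^sub>R y"
    using c by (intro scaleR_left_mono) simp_all
  then have "inverse c * coord e (c *\<^sub>R y) \<le> coord e y"
    using c by (intro le_coord[OF arch e]) simp
  then show "coord e (c *\<^sub>R y) \<le> c * coord e y"
    using c by (simp add: field_simps)
  have "c *\<^sub>R coord e y *\<^sub>R e \<le> c *\<^sub>R y"
    using c by (intro scaleR_left_mono coord_scaleR_le[OF arch e y]) simp
  then show "c * coord e y \<le> coord e (c *\<^sub>R y)"
    by (intro le_coord[OF arch e]) simp
qed

lemma atom_pos: "atom a \<Longrightarrow> 0 < a"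
  by (simp add: atom_def less_le)

lemma le_scaleR_atom:
  fixes e y :: "'y::ordered_real_vector"
  assumes e: "atom e" and "0 \<le> y" and "y \<le> c *\<^sub>R e" and c: "0 \<le> c"
  obtains d where "0 \<le> d" and "y = d *\<^sub>R e"
proof (cases "c = 0")
  case True
  then show ?thesis
    using assms that[of 0] by simp
next
  case False
  with c have "0 < c"
    by simp
  have "inverse c *\<^sub>R y \<le> inverse c *\<^sub>R c *\<^sub>R e"
    using assms by (intro scaleR_left_mono) simp_all
  then have "inverse c *\<^sub>R y \<le> e" and "0 \<le> inverse c *\<^sub>R y"
    using assms \<open>0 < c\<close> by (simp_all add: scaleR_nonneg_nonneg)
  then obtain d where "0 \<le> d" "inverse c *\<^sub>R y = d *\<^sub>R e"
    using e unfolding atom_def by blast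
  then have "y = (c * d) *\<^sub>R e"
    using \<open>0 < c\<close> by (metis less_irrefl right_inverse scaleR_one scaleR_scaleR)
  then show ?thesis
    using \<open>0 \<le> d\<close> c that[of "c * d"] by simp
qed

lemma coord_add:
  fixes e x y :: "'y::{ordered_real_vector, lattice}"
  assumes arch: "archimedean TYPE('y)" and atom: "atom e" and x: "0 \<le> x" and y: "0 \<le> y"
  shows "coord e (x + y) = coord e x + coord e y"
proof (rule antisym)
  note e = atom_pos[OF atom]
  note coord_le = coord_scaleR_le[OF arch e]
  define c where "c = coord e (x + y)"
  have c: "0 \<le> c"
    unfolding c_def using x y by (intro coord_nonneg[OF arch e]) simp
  have ce: "c *\<^sub>R e \<le> x + y"
    unfolding c_def using x y by (intro coord_le) simp
  have ce0: "0 \<le> c *\<^sub>R e"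
    using c e by (simp add: scaleR_nonneg_nonneg)
  \<comment> \<open>Riesz decomposition of \<open>c *\<^sub>R e\<close> into a part below \<open>x\<close> and a part below \<open>y\<close>\<close>
  define p where "p = inf (c *\<^sub>R e) x"
  have p: "0 \<le> p" "p \<le> c *\<^sub>R e" "p \<le> x"
    using ce0 x by (simp_all add: p_def)
  have "c *\<^sub>R e - y \<le> p"
    unfolding p_def using ce y by (intro inf_greatest) (simp_all add: algebra_simps)
  then have q: "c *\<^sub>R e - p \<le> y"
    by (simp add: algebra_simps)
  obtain d where d: "p = d *\<^sub>R e"
    using le_scaleR_atom[OF atom p(1,2) c] by metis
  have "d \<le> coord e x"
    using p(3) d by (intro le_coord[OF arch e]) simp
  moreover have "c - d \<le> coord e y"
    using q d by (intro le_coord[OF arch e]) (simp add: algebra_simps)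
  ultimately show "coord e (x + y) \<le> coord e x + coord e y"
    unfolding c_def by simp
  have "coord e x *\<^sub>R e + coord e y *\<^sub>R e \<le> x + y"
    using x y by (intro add_mono coord_le)
  then show "coord e x + coord e y \<le> coord e (x + y)"
    by (intro le_coord[OF arch e]) (simp add: scaleR_left_distrib)
qed

section \<open>Transfer to a vector lattice cover\<close>

lemma order_dense_le:
  assumes "order_dense D" and "\<And>z. z \<in> D \<Longrightarrow> y \<le> z \<Longrightarrow> l \<le> z"
  shows "l \<le> y"
proof -
  have "isGlb UNIV {z \<in> D. y \<le> z} y"
    using assms(1) by (simp add: order_dense_def)
  moreover have "isLb UNIV {z \<in> D. y \<le> z} l"
    using assms(2) by (simp add: isLb_def setge_def)
  ultimately show ?thesis
    by (rule isGlb_le_isLb)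
qed

lemma order_dense_majorizing:
  assumes "order_dense D"
  obtains z where "z \<in> D" and "y \<le> z"
proof -
  have "\<exists>z\<in>D. y \<le> z"
  proof (rule ccontr)
    assume none: "\<not> (\<exists>z\<in>D. y \<le> z)"
    \<comment> \<open>Every element is a lower bound of the empty set, so \<open>y\<close> is a largest element.\<close>
    then have "y + y \<le> y"
      using order_dense_le[OF assms, of y "y + y"] by blast
    then have "y \<le> 0"
      by simp
    moreover have "0 \<in> D"
      using assms by (simp add: order_dense_def subspace_def)
    ultimately show False
      using none by blast
  qed
  then show ?thesis
    using that by blast
qed

text \<open>
  A vector lattice cover \<open>i\<close> of \<open>X\<close> that witnesses pervasiveness: below every positive nonzero
  element of the lattice there is a positive nonzero element of the image of \<open>X\<close>.
\<close>

locale pervasive_cover =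
  fixes i :: "'a::ordered_real_vector \<Rightarrow> 'y::{ordered_real_vector, lattice}"
  assumes cover_map: "vector_lattice_cover i"
    and ex_below: "0 \<le> y \<Longrightarrow> y \<noteq> 0 \<Longrightarrow> \<exists>x. 0 < i x \<and> i x \<le> y"
begin

lemma linear: "linear i"
  using cover_map by (simp add: vector_lattice_cover_def)

lemma order_dense: "order_dense (range i)"
  using cover_map by (simp add: vector_lattice_cover_def)

lemma le_iff: "i x \<le> i y \<longleftrightarrow> x \<le> y"
proof -
  have "0 \<le> i (y - x) \<longleftrightarrow> 0 \<le> y - x"
    using cover_map by (simp add: vector_lattice_cover_def bipositive_def)
  then show ?thesis
    by (simp add: linear_diff[OF linear])
qed

lemma eq_iff: "i x = i y \<longleftrightarrow> x = y"
  by (metis le_iff order_antisym order_refl)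

lemma nonneg_iff: "0 \<le> i x \<longleftrightarrow> 0 \<le> x"
  using le_iff[of 0 x] by (simp add: linear_0[OF linear])

lemma archimedean_cover:
  assumes arch: "archimedean TYPE('a)"
  shows "archimedean TYPE('y)"
  unfolding archimedean_def
proof (intro allI impI)
  fix y w :: 'y
  assume le: "\<forall>n. real n *\<^sub>R y \<le> w"
  show "y \<le> 0"
  proof (rule ccontr)
    assume "\<not> y \<le> 0"
    then have "sup y 0 \<noteq> 0"
      by (metis sup_ge1)
    then obtain x where x: "0 < i x" "i x \<le> sup y 0"
      using ex_below[of "sup y 0"] by auto
    obtain z where z: "sup w 0 \<le> i z"
      using order_dense_majorizing[OF order_dense] by blast
    have "real n *\<^sub>R x \<le> z" for n
    proof (cases "n = 0")
      case True
      have "0 \<le> i z"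
        using z by (metis order_trans sup_ge2)
      then show ?thesis
        using True by (simp add: nonneg_iff)
    next
      case False
      have "inverse (real n) *\<^sub>R (real n *\<^sub>R y) \<le> inverse (real n) *\<^sub>R sup w 0"
        using le by (intro scaleR_left_mono) (auto intro: le_supI1)
      then have "y \<le> inverse (real n) *\<^sub>R sup w 0"
        using False by simp
      then have "sup y 0 \<le> inverse (real n) *\<^sub>R sup w 0"
        by (simp add: scaleR_nonneg_nonneg)
      with x(2) have "i x \<le> inverse (real n) *\<^sub>R sup w 0"
        by (rule order_trans)
      then have "real n *\<^sub>R i x \<le> real n *\<^sub>R (inverse (real n) *\<^sub>R sup w 0)"
        by (rule scaleR_left_mono) simp
      then have "real n *\<^sub>R i x \<le> sup w 0"
        using False by simp
      then have "real n *\<^sub>R i x \<le> i z"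
        using z by (rule order_trans)
      then have "i (real n *\<^sub>R x) \<le> i z"
        by (simp only: linear_scale[OF linear])
      then show ?thesis
        by (simp add: le_iff)
    qed
    then have "x \<le> 0"
      using arch unfolding archimedean_def by blast
    then have "i x \<le> 0"
      using le_iff[of x 0] by (simp add: linear_0[OF linear])
    with x(1) show False
      by simp
  qed
qed

lemma atom_cover:
  assumes arch: "archimedean TYPE('a)" and atom: "atom a"
  shows "atom (i a)"
proof -
  note archY = archimedean_cover[OF arch]
  let ?e = "i a"
  have a: "0 \<le> a" "a \<noteq> 0"
    using atom by (simp_all add: atom_def)
  have "0 \<le> ?e" "?e \<noteq> 0"
    using a eq_iff[of a 0] by (simp_all add: nonneg_iff linear_0[OF linear])
  then have e: "0 < ?e"
    by simp
  have "y = coord ?e y *\<^sub>R ?e" if y: "0 \<le> y" "y \<le> ?e" for y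
  proof (rule ccontr)
    let ?l = "coord ?e y"
    assume "y \<noteq> ?l *\<^sub>R ?e"
    moreover have "0 \<le> y - ?l *\<^sub>R ?e"
      using coord_scaleR_le[OF archY e y(1)] by simp
    ultimately obtain x where x: "0 < i x" "i x \<le> y - ?l *\<^sub>R ?e"
      using ex_below[of "y - ?l *\<^sub>R ?e"] by auto
    have "y - ?l *\<^sub>R ?e \<le> y"
      using coord_nonneg[OF archY e y(1)] e by (simp add: scaleR_nonneg_nonneg)
    with x y(2) have "i x \<le> ?e"
      by (meson order_trans)
    moreover have "0 \<le> x"
      using x(1) by (simp flip: nonneg_iff)
    ultimately obtain c where c: "0 \<le> c" "x = c *\<^sub>R a"
      using atom unfolding atom_def le_iff by blast
    \<comment> \<open>If \<open>c > 0\<close>, then \<open>c + ?l\<close> contradicts the maximality of \<open>?l\<close>.\<close>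
    have "(c + ?l) *\<^sub>R ?e \<le> y"
      using x(2) c(2) by (simp add: linear_scale[OF linear] algebra_simps)
    then have "c + ?l \<le> ?l"
      by (rule le_coord[OF archY e])
    with c x(1) show False
      by (simp add: linear_0[OF linear])
  qed
  then have "\<exists>c\<ge>0. y = c *\<^sub>R ?e" if "0 \<le> y" "y \<le> ?e" for y
    using that coord_nonneg[OF archY e] by blast
  then show ?thesis
    using e by (auto simp: atom_def)
qed

text \<open>
  An upper bound in the image of \<open>X\<close> of both \<open>i z - i x\<close> and \<open>i x - i z\<close> is one of \<open>i z + i x\<close>;
  order density turns this into an inequality in the lattice.
\<close>

lemma disjoint_eltsD:
  assumes "disjoint_elts z x"
  shows "i z + i x \<le> sup (i z - i x) (i x - i z)"
proof (rule order_dense_le[OF order_dense])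
  fix w
  assume "w \<in> range i" and le: "sup (i z - i x) (i x - i z) \<le> w"
  then obtain t where t: "w = i t"
    by blast
  have "i (z - x) \<le> i t" "i (- z + x) \<le> i t"
    using le t by (simp_all add: linear_diff[OF linear] linear_add[OF linear] linear_neg[OF linear])
  then have "t \<in> upper_bounds {z - x, - z + x}"
    by (simp add: upper_bounds_def le_iff)
  then have "t \<in> upper_bounds {z + x, - z - x}"
    using assms by (simp add: disjoint_elts_def)
  then have "i (z + x) \<le> i t"
    by (simp add: upper_bounds_def le_iff)
  then show "i z + i x \<le> w"
    by (simp add: t linear_add[OF linear])
qed

text \<open>Positive elements whose images have infimum \<open>0\<close> in the lattice are disjoint in \<open>X\<close>.\<close>

lemma disjoint_eltsI:
  assumes z: "0 \<le> z" and b: "0 \<le> b"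
    and meet: "\<And>h. h \<le> i z \<Longrightarrow> h \<le> i b \<Longrightarrow> h \<le> 0"
  shows "disjoint_elts z b"
  unfolding disjoint_elts_def
proof (rule set_eqI)
  fix w
  have "z + b \<le> w" "- z - b \<le> w" if w: "z - b \<le> w" "- z + b \<le> w"
  proof -
    \<comment> \<open>\<open>z + b - w\<close> is below both \<open>2 *\<^sub>R z\<close> and \<open>2 *\<^sub>R b\<close>, so half of it is a common lower bound.\<close>
    let ?h = "(1/2) *\<^sub>R i (z + b - w)"
    have "z + b - w \<le> 2 *\<^sub>R b" "z + b - w \<le> 2 *\<^sub>R z"
      using w by (simp_all add: scaleR_2 algebra_simps)
    then have "i (z + b - w) \<le> 2 *\<^sub>R i b" "i (z + b - w) \<le> 2 *\<^sub>R i z"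
      by (simp_all add: le_iff flip: linear_scale[OF linear])
    then have "?h \<le> (1/2) *\<^sub>R 2 *\<^sub>R i b" "?h \<le> (1/2) *\<^sub>R 2 *\<^sub>R i z"
      by (intro scaleR_left_mono; simp)+
    then have "?h \<le> 0"
      by (intro meet) simp_all
    then have "i (z + b - w) \<le> 0"
      by (simp add: scaleR_le_0_iff)
    then have "z + b - w \<le> 0"
      using le_iff[of "z + b - w" 0] by (simp add: linear_0[OF linear])
    then show "z + b \<le> w"
      by simp
    moreover have "0 \<le> z + b"
      using z b by simp
    moreover from this have "- z - b \<le> 0"
      by (simp flip: neg_le_0_iff_le[of "z + b"])
    ultimately show "- z - b \<le> w"
      by (meson order_trans)
  qed
  moreover have "z - b \<le> w" "- z + b \<le> w" if "z + b \<le> w"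
  proof -
    have "z - b \<le> z + b" "- z + b \<le> z + b"
      using add_mono[OF order_refl[of z], of "- b" b] add_mono[OF _ order_refl[of b], of "- z" z] z b
      by (auto intro: order_trans[of _ 0])
    with that show "z - b \<le> w" "- z + b \<le> w"
      by (meson order_trans)+
  qed
  ultimately show "w \<in> upper_bounds {z + b, - z - b} \<longleftrightarrow> w \<in> upper_bounds {z - b, - z + b}"
    by (auto simp: upper_bounds_def)
qed

end

section \<open>The line spanned by an atom is a band\<close>

lemma disjoint_elts_commute: "disjoint_elts x y \<longleftrightarrow> disjoint_elts y x"
proof -
  have "{x + y, - x - y} = {y + x, - y - x}" "{x - y, - x + y} = {y - x, - y + x}"
    by auto
  then show ?thesis
    by (simp only: disjoint_elts_def)
qed

lemma disjoint_elts_minus_right: "disjoint_elts x (- y) \<longleftrightarrow> disjoint_elts x y"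
  by (auto simp: disjoint_elts_def)

context pervasive_cover
begin

lemma band_line:
  fixes a :: 'a
  assumes arch: "archimedean TYPE('a)" and atom: "atom a"
  shows "band (range (\<lambda>c. c *\<^sub>R a))" (is "band ?L")
proof -
  note archY = archimedean_cover[OF arch]
  note atomY = atom_cover[OF arch atom]
  note e = atom_pos[OF atomY]
  let ?e = "i a"

  have disjoint_line: "z \<in> disjoint_compl ?L" if z: "0 \<le> i z" and coord0: "coord ?e (i z) = 0" for z
  proof -
    have pos: "disjoint_elts z (c *\<^sub>R a)" if c: "0 \<le> c" for c
    proof (rule disjoint_eltsI)
      show "0 \<le> z" "0 \<le> c *\<^sub>R a"
        using z c atom by (simp_all add: nonneg_iff atom_def scaleR_nonneg_nonneg)
      fix h
      assume h: "h \<le> i z" "h \<le> i (c *\<^sub>R a)"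
      have "sup h 0 \<le> c *\<^sub>R ?e"
        using h c e by (simp add: linear_scale[OF linear] scaleR_nonneg_nonneg)
      then obtain d where d: "0 \<le> d" "sup h 0 = d *\<^sub>R ?e"
        using le_scaleR_atom[OF atomY _ _ c] by (metis sup_ge2)
      have "d *\<^sub>R ?e \<le> i z"
        using h z by (simp flip: d(2))
      then have "d \<le> 0"
        using le_coord[OF archY e] coord0 by metis
      with d have "sup h 0 = 0"
        by simp
      then show "h \<le> 0"
        by (metis sup_ge1)
    qed
    have "disjoint_elts z (c *\<^sub>R a)" for c
      using pos[of c] pos[of "- c"] disjoint_elts_minus_right[of z "c *\<^sub>R a"]
      by (cases "0 \<le> c") simp_all
    then show ?thesis
      by (auto simp: disjoint_compl_def)
  qed

  have pos_part: "sup u 0 = coord ?e (sup u 0) *\<^sub>R ?e"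
    if u: "\<And>z. z \<in> disjoint_compl ?L \<Longrightarrow> i z + u \<le> sup (i z - u) (u - i z)" for u
  proof (rule ccontr)
    let ?l = "coord ?e (sup u 0)"
    let ?r = "sup u 0 - ?l *\<^sub>R ?e"
    assume "sup u 0 \<noteq> ?l *\<^sub>R ?e"
    moreover have "0 \<le> ?r"
      using coord_scaleR_le[OF archY e] by simp
    ultimately obtain z where z: "0 < i z" "i z \<le> ?r"
      using ex_below[of ?r] by auto
    have iz0: "0 \<le> i z"
      using z(1) by simp
    \<comment> \<open>By the maximality of \<open>?l\<close>, no positive multiple of \<open>?e\<close> lies below \<open>?r\<close>.\<close>
    have "coord ?e (i z) *\<^sub>R ?e \<le> ?r"
      using coord_scaleR_le[OF archY e iz0] z(2) by (rule order_trans)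
    then have "(coord ?e (i z) + ?l) *\<^sub>R ?e \<le> sup u 0"
      by (simp add: algebra_simps)
    then have "coord ?e (i z) + ?l \<le> ?l"
      by (rule le_coord[OF archY e])
    then have "coord ?e (i z) = 0"
      using coord_nonneg[OF archY e iz0] by simp
    then have "i z + u \<le> sup (i z - u) (u - i z)"
      using iz0 by (intro u disjoint_line)
    moreover have "i z \<le> sup u 0"
    proof -
      have "?r \<le> sup u 0"
        using coord_nonneg[OF archY e, of "sup u 0"] e by (simp add: scaleR_nonneg_nonneg)
      with z(2) show ?thesis
        by (rule order_trans)
    qed
    ultimately have "i z \<le> 0"
      using iz0 by (intro le_pos_part_disjoint_imp_le_0)
    with z(1) show False
      by simp
  qed

  have "x \<in> ?L" if x: "x \<in> disjoint_compl (disjoint_compl ?L)" for x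
  proof -
    have disj: "disjoint_elts z x" if "z \<in> disjoint_compl ?L" for z
      using x that by (auto simp: disjoint_compl_def disjoint_elts_commute)
    have disj': "disjoint_elts z (- x)" if "z \<in> disjoint_compl ?L" for z
      using disj[OF that] by (simp add: disjoint_elts_minus_right)
    let ?p = "sup (i x) 0" and ?n = "sup (i (- x)) 0"
    have "?p = coord ?e ?p *\<^sub>R ?e"
      by (intro pos_part disjoint_eltsD disj)
    moreover have "?n = coord ?e ?n *\<^sub>R ?e"
      by (intro pos_part disjoint_eltsD disj')
    moreover have "i x = ?p - ?n"
      by (simp add: pos_part_minus_neg_part linear_neg[OF linear])
    ultimately have "i x = (coord ?e ?p - coord ?e ?n) *\<^sub>R ?e"
      by (metis scaleR_left_diff_distrib)
    then have "i x = i ((coord ?e ?p - coord ?e ?n) *\<^sub>R a)"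
      by (simp only: linear_scale[OF linear])
    then show ?thesis
      unfolding eq_iff by blast
  qed
  moreover have "?L \<subseteq> disjoint_compl (disjoint_compl ?L)"
    by (auto simp: disjoint_compl_def disjoint_elts_commute)
  moreover have "subspace ?L"
    by (simp flip: span_singleton)
  ultimately show ?thesis
    unfolding band_def by blast
qed

lemma generated_band_eq_line:
  fixes a :: 'a
  assumes "archimedean TYPE('a)" and "atom a"
  shows "generated_band a = range (\<lambda>c. c *\<^sub>R a)" (is "_ = ?L")
proof
  have "a \<in> ?L"
    by (metis rangeI scaleR_one)
  then show "generated_band a \<subseteq> ?L"
    unfolding generated_band_def using band_line[OF assms] by blast
  show "?L \<subseteq> generated_band a"
    by (auto simp: generated_band_def band_def intro: subspace_scale)
qed

end

section \<open>The projection\<close>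

theorem corollary44:
  fixes a :: "'a::ordered_real_vector"
  assumes "archimedean TYPE('a)"
    and "pre_Riesz_space TYPE('a) TYPE('y::{ordered_real_vector, lattice})"
    and "pervasive_space TYPE('a) TYPE('y)"
    and "atom a"
  shows "\<exists>P :: 'a \<Rightarrow> 'a. order_projection P \<and> range P = generated_band a"
proof -
  obtain i :: "'a \<Rightarrow> 'y" where "pervasive_cover i"
    using assms(3) unfolding pervasive_space_def pervasive_cover_def by blast
  then interpret pervasive_cover i .
  let ?e = "i a"
  note archY = archimedean_cover[OF assms(1)]
  note atomY = atom_cover[OF assms(1,4)]
  note e = atom_pos[OF atomY]
  obtain g where g: "linear g" and g_coord: "\<And>y. 0 \<le> y \<Longrightarrow> g y = coord ?e y"
    by (rule linear_extension_from_cone[of "coord ?e"])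
      (use coord_add[OF archY atomY] coord_scaleR[OF archY e] in blast)+
  define P where "P x = g (i x) *\<^sub>R a" for x
  have a: "0 \<le> a"
    using assms(4) by (simp add: atom_def)
  have g_a: "g ?e = 1"
    using e by (simp add: g_coord coord_self[OF archY e])
  have P_line: "P (c *\<^sub>R a) = c *\<^sub>R a" for c
    by (simp add: P_def linear_scale[OF linear] linear_scale[OF g] g_a)
  have P_bounds: "0 \<le> P x" "P x \<le> x" if "0 \<le> x" for x
  proof -
    have ix: "0 \<le> i x"
      using that by (simp add: nonneg_iff)
    show "0 \<le> P x"
      using a ix coord_nonneg[OF archY e] by (simp add: P_def g_coord scaleR_nonneg_nonneg)
    have "i (P x) \<le> i x"
      using ix coord_scaleR_le[OF archY e] by (simp add: P_def g_coord linear_scale[OF linear])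
    then show "P x \<le> x"
      by (simp add: le_iff)
  qed
  have "linear P"
    unfolding P_def
    by (rule linearI)
      (simp_all add: linear_add[OF linear] linear_add[OF g] linear_scale[OF linear]
        linear_scale[OF g] scaleR_left_distrib)
  moreover have "P \<circ> P = P"
  proof
    fix x
    show "(P \<circ> P) x = P x"
      using P_line[of "g (i x)"] by (simp add: P_def)
  qed
  ultimately have "order_projection P"
    using P_bounds by (simp add: order_projection_def operator_le_def)
  moreover have "range P = generated_band a"
  proof -
    have "range P \<subseteq> range (\<lambda>c. c *\<^sub>R a)"
      by (auto simp: P_def)
    moreover have "range (\<lambda>c. c *\<^sub>R a) \<subseteq> range P"
      using P_line by (metis image_subsetI rangeI)
    ultimately have "range P = range (\<lambda>c. c *\<^sub>R a)"
      by (rule antisym)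
    then show ?thesis
      by (simp add: generated_band_eq_line[OF assms(1,4)])
  qed
  ultimately show ?thesis
    by blast
qed

end
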